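(* Let $n\ge1$ and let $s$ be a self-adjoint $M_n(\mathbb{C})$-valued semicircular random variable with operator-valued Cauchy transform $G_s:\mathbb{H}^+(M_n(\mathbb{C}))\to\mathbb{H}^-(M_n(\mathbb{C}))$ satisfying $$b\,G_s(b)=1+(D+\eta(G_s(b)))\,G_s(b)\qquad (b\in\mathbb{H}^+(M_n(\mathbb{C}))),$$ where $D=0$ and $\eta:M_n(\mathbb{C})\to M_n(\mathbb{C})$ is a nilpotent completely positive map. Then the probability measure $\mu_s$ on $\mathbb{R}$ associated to $G_s$ has at least one atom.
   Context: A linear map $\eta$ is nilpotent if its $m$-fold composition $\eta^m$ is $0$ for some $m\ge1$. Operator-valued semicircular random variables: let $A$ be a unital $C^*$-algebra, $\mathcal{B}\subseteq A$ a unital $C^*$-subalgebra (here $\mathcal{B}=M_n(\mathbb{C})$), and $E:A\to\mathcal{B}$ a conditional expectation, i.e. a linear map with $E(b_1ab_2)=b_1E(a)b_2$ for $a\in A$, $b_1,b_2\in\mathcal{B}$, $E(1)=1$, and $E(a^*a)\ge0$. Put $\mathbb{H}^{\pm}(\mathcal{B})=\{b\in\mathcal{B}:\pm\mathrm{Im}(b)\geq\epsilon\cdot1\text{ for some }\epsilon>0\}$, where $\mathrm{Im}(b)=(b-b^* )/(2i)$. The operator-valued Cauchy transform of a self-adjoint $a\in A$ is $G_a:\mathbb{H}^+(\mathcal{B})\to\mathbb{H}^-(\mathcal{B})$, $G_a(b)=E((b-a)^{-1})$. For a self-adjoint $D\in\mathcal{B}$ and a completely positive map $\eta:\mathcal{B}\to\mathcal{B}$,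 a self-adjoint $s\in A$ is called a $\mathcal{B}$-valued semicircular random variable with first moment $D$ and variance $\eta$ if its operator-valued $R$-transform, determined by $bG_s(b)=1+R_s(G_s(b))G_s(b)$, is $R_s(b)=D+\eta(b)$. Then $D=E(s)$ and $\eta(b)=E(sbs)-E(s)bE(s)$, and equivalently $G_s$ is the unique solution $\mathbb{H}^+(\mathcal{B})\to\mathbb{H}^-(\mathcal{B})$ of $bG_s(b)=1+(D+\eta(G_s(b)))G_s(b)$ with $\lim_{b^{-1}\to0}bG_s(b)=1$. Associated measure: with $\mathrm{tr}_n$ the normalized trace on $M_n(\mathbb{C})$, the associated probability measure (distribution) $\mu_s$ is the unique probability measure on $\mathbb{R}$ with $\mathrm{tr}_n(G_s(\xi\cdot1))=\int_{\mathbb{R}}\frac{d\mu_s(t)}{\xi-t}$ for all $\xi\in\mathbb{C}$ with $\mathrm{Im}\,\xi>0$. An atom of $\mu_s$ is a point $r\in\mathbb{R}$ with $\mu_s(\{r\})>0$. *)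

theory Defs
  imports "HOL-Probability.Probability"
begin

section \<open>Unital C*-algebras\<close>

text \<open>
  The sort \<open>real_normed_algebra_1\<close> contains \<open>norm 1 = 1\<close>, so only the zero algebra is
  excluded, which does not contain a copy of the \<open>n \<times> n\<close> matrices for \<open>n \<ge> 1\<close>.
\<close>

class cstar_algebra = real_normed_algebra_1 + banach +
  fixes scaleC :: "complex \<Rightarrow> 'a \<Rightarrow> 'a" (infixr \<open>*\<^sub>C\<close> 75)
    and star :: "'a \<Rightarrow> 'a"
  assumes scaleC_add_right: "c *\<^sub>C (x + y) = c *\<^sub>C x + c *\<^sub>C y"
    and scaleC_add_left: "(c + d) *\<^sub>C x = c *\<^sub>C x + d *\<^sub>C x"
    and scaleC_scaleC: "c *\<^sub>C (d *\<^sub>C x) = (c * d) *\<^sub>C x"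
    and scaleC_of_real: "complex_of_real r *\<^sub>C x = r *\<^sub>R x"
    and norm_scaleC: "norm (c *\<^sub>C x) = cmod c * norm x"
    and scaleC_mult_left: "(c *\<^sub>C x) * y = c *\<^sub>C (x * y)"
    and scaleC_mult_right: "x * (c *\<^sub>C y) = c *\<^sub>C (x * y)"
    and star_add: "star (x + y) = star x + star y"
    and star_scaleC: "star (c *\<^sub>C x) = cnj c *\<^sub>C star x"
    and star_mult: "star (x * y) = star y * star x"
    and star_star: "star (star x) = x"
    and norm_star_mult_self: "norm (star x * x) = (norm x)\<^sup>2"

definition self_adjoint :: "'a::cstar_algebra \<Rightarrow> bool" where
  "self_adjoint a \<longleftrightarrow> star a = a"

text \<open>Only meaningful when \<open>x\<close> is invertible; the two-sided inverse is then unique.\<close>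

definition alg_inverse :: "'a::ring_1 \<Rightarrow> 'a" where
  "alg_inverse x = (THE y. x * y = 1 \<and> y * x = 1)"

section \<open>The algebra of complex matrices\<close>

text \<open>
  Products are \<open>**\<close>, the unit is \<open>mat 1\<close> and \<open>mat \<xi>\<close> is the scalar matrix \<open>\<xi>\<cdot>1\<close>. (The
  type-class product \<open>*\<close> on vectors is componentwise and is not used.)
\<close>

definition cmat_scale :: "complex \<Rightarrow> complex^'n^'n \<Rightarrow> complex^'n^'n" where
  "cmat_scale c b = (\<chi> i j. c * b $ i $ j)"

definition cmat_adjoint :: "complex^'n^'n \<Rightarrow> complex^'n^'n" where
  "cmat_adjoint b = (\<chi> i j. cnj (b $ j $ i))"

lemma vector_space_scaleC:
  "vector_space (scaleC :: complex \<Rightarrow> 'a::cstar_algebra \<Rightarrow> 'a)"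
proof
  show "1 *\<^sub>C x = x" for x :: 'a
    using scaleC_of_real[of 1 x] by simp
qed (simp_all add: scaleC_add_right scaleC_add_left scaleC_scaleC)

lemma vector_space_cmat_scale:
  "vector_space (cmat_scale :: complex \<Rightarrow> complex^'n^'n \<Rightarrow> complex^'n^'n)"
  by standard (simp_all add: cmat_scale_def vec_eq_iff algebra_simps)

definition cvec_inner :: "complex^'n \<Rightarrow> complex^'n \<Rightarrow> complex" where
  "cvec_inner u v = (\<Sum>i\<in>UNIV. cnj (u $ i) * v $ i)"

text \<open>
  Over the complex numbers, membership of all values of the quadratic form in
  \<open>\<real>\<^sub>\<ge>\<^sub>0\<close> includes self-adjointness.
\<close>

definition cmat_nonneg :: "complex^'n^'n \<Rightarrow> bool" where
  "cmat_nonneg b \<longleftrightarrow> (\<forall>v. cvec_inner v (b *v v) \<in> \<real>\<^sub>\<ge>\<^sub>0)"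

text \<open>
  Positivity of the \<open>k \<times> k\<close> block matrix with blocks \<open>b i j\<close>, \<open>i, j < k\<close>, as an element
  of \<open>M\<^sub>k(M\<^sub>n(\<complex>))\<close> acting on \<open>(\<complex>\<^sup>n)\<^sup>k\<close>.
\<close>

definition block_nonneg :: "nat \<Rightarrow> (nat \<Rightarrow> nat \<Rightarrow> complex^'n^'n) \<Rightarrow> bool" where
  "block_nonneg k b \<longleftrightarrow>
     (\<forall>v :: nat \<Rightarrow> complex^'n. (\<Sum>i<k. \<Sum>j<k. cvec_inner (v i) (b i j *v v j)) \<in> \<real>\<^sub>\<ge>\<^sub>0)"

definition completely_positive :: "(complex^'n^'n \<Rightarrow> complex^'n^'n) \<Rightarrow> bool" where
  "completely_positive \<eta> \<longleftrightarrow>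
     Vector_Spaces.linear cmat_scale cmat_scale \<eta> \<and>
     (\<forall>k b. block_nonneg k b \<longrightarrow> block_nonneg k (\<lambda>i j. \<eta> (b i j)))"

definition nilpotent_map :: "('a::zero \<Rightarrow> 'a) \<Rightarrow> bool" where
  "nilpotent_map \<eta> \<longleftrightarrow> (\<exists>m\<ge>1. \<eta> ^^ m = (\<lambda>_. 0))"

definition cmat_Im :: "complex^'n^'n \<Rightarrow> complex^'n^'n" where
  "cmat_Im b = cmat_scale (1 / (2 * \<i>)) (b - cmat_adjoint b)"

definition upper_half :: "(complex^'n^'n) set" where
  "upper_half = {b. \<exists>\<epsilon>>0. cmat_nonneg (cmat_Im b - mat (complex_of_real \<epsilon>))}"

section \<open>Matrix-valued semicircular random variables\<close>

text \<open>
  The unital C*-subalgebra \<open>\<B> \<cong> M\<^sub>n(\<complex>)\<close> of \<open>A\<close> is given by an injective unital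
  *-homomorphism \<open>\<iota>\<close> of \<open>M\<^sub>n(\<complex>)\<close> onto it, and conditional expectations onto \<open>\<B>\<close> are
  written as maps into \<open>M\<^sub>n(\<complex>)\<close>.
\<close>

definition unital_star_embedding :: "(complex^'n^'n \<Rightarrow> 'a::cstar_algebra) \<Rightarrow> bool" where
  "unital_star_embedding \<iota> \<longleftrightarrow>
     Vector_Spaces.linear cmat_scale scaleC \<iota> \<and> inj \<iota> \<and>
     \<iota> (mat 1) = 1 \<and>
     (\<forall>b c. \<iota> (b ** c) = \<iota> b * \<iota> c) \<and>
     (\<forall>b. \<iota> (cmat_adjoint b) = star (\<iota> b))"

definition conditional_expectation ::
  "(complex^'n^'n \<Rightarrow> 'a::cstar_algebra) \<Rightarrow> ('a \<Rightarrow> complex^'n^'n) \<Rightarrow> bool" where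
  "conditional_expectation \<iota> E \<longleftrightarrow>
     Vector_Spaces.linear scaleC cmat_scale E \<and>
     (\<forall>b a c. E (\<iota> b * a * \<iota> c) = b ** E a ** c) \<and>
     E 1 = mat 1 \<and>
     (\<forall>a. cmat_nonneg (E (star a * a)))"

text \<open>\<open>\<iota> b - a\<close> is invertible for self-adjoint \<open>a\<close> and \<open>b \<in> upper_half\<close>.\<close>

definition cauchy_transform ::
  "(complex^'n^'n \<Rightarrow> 'a::cstar_algebra) \<Rightarrow> ('a \<Rightarrow> complex^'n^'n) \<Rightarrow> 'a
     \<Rightarrow> complex^'n^'n \<Rightarrow> complex^'n^'n" where
  "cauchy_transform \<iota> E a b = E (alg_inverse (\<iota> b - a))"

text \<open>
  The operator-valued R-transform is \<open>b \<mapsto> D + \<eta> b\<close>, with its defining relation to the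
  Cauchy transform imposed on the whole upper half-plane.
\<close>

definition semicircular ::
  "(complex^'n^'n \<Rightarrow> 'a::cstar_algebra) \<Rightarrow> ('a \<Rightarrow> complex^'n^'n)
     \<Rightarrow> complex^'n^'n \<Rightarrow> (complex^'n^'n \<Rightarrow> complex^'n^'n) \<Rightarrow> 'a \<Rightarrow> bool" where
  "semicircular \<iota> E D \<eta> s \<longleftrightarrow>
     self_adjoint s \<and> cmat_adjoint D = D \<and> completely_positive \<eta> \<and>
     (\<forall>b\<in>upper_half.
        b ** cauchy_transform \<iota> E s b =
        mat 1 + (D + \<eta> (cauchy_transform \<iota> E s b)) ** cauchy_transform \<iota> E s b)"

text \<open>
  By Stieltjes inversion there is at most one such \<open>\<mu>\<close>. The integrand is bounded and
  continuous, hence integrable.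
\<close>

definition associated_measure ::
  "(complex^'n^'n \<Rightarrow> complex^'n^'n) \<Rightarrow> real measure \<Rightarrow> bool" where
  "associated_measure G \<mu> \<longleftrightarrow>
     real_distribution \<mu> \<and>
     (\<forall>\<xi>. Im \<xi> > 0 \<longrightarrow>
        trace (G (mat \<xi>)) / of_nat CARD('n) =
        (\<integral>t. 1 / (\<xi> - complex_of_real t) \<partial>\<mu>))"

definition atom :: "real measure \<Rightarrow> real \<Rightarrow> bool" where
  "atom \<mu> r \<longleftrightarrow> measure \<mu> {r} > 0"

end

theory Submission
  imports Defs
begin

text \<open>
  If \<open>\<eta>(1)\<close> were invertible, then \<open>\<eta>(1) \<ge> c\<close> for some \<open>c > 0\<close>, hence \<open>\<eta>\<^sup>m(1) \<ge> c\<^sup>m\<close> for all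
  \<open>m\<close>, contradicting nilpotency. So there is a vector \<open>v \<noteq> 0\<close> with \<open>\<langle>v, \<eta>(1) v\<rangle> = 0\<close>, and by
  positivity \<open>\<eta>(b) v = 0\<close> for every \<open>b\<close>. As \<open>G(\<xi>) (\<xi> - \<eta>(G(\<xi>))) = 1\<close>, this gives
  \<open>G(\<xi>) v = v / \<xi>\<close>. Since \<open>- Im G(iy)\<close> is positive, its trace dominates its quadratic form
  at \<open>v\<close> up to a constant, so \<open>- Im tr G(iy) \<ge> c / y\<close> for some \<open>c > 0\<close>. Letting \<open>y \<rightarrow> 0\<close> in
  \<open>- y Im tr G(iy) = \<integral> y\<^sup>2 / (y\<^sup>2 + t\<^sup>2) d\<mu>(t)\<close> yields \<open>\<mu>({0}) \<ge> c\<close>.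
\<close>

section \<open>Positive matrices\<close>

lemma cvec_inner_add_left: "cvec_inner (u + w) v = cvec_inner u v + cvec_inner w v"
  and cvec_inner_add_right: "cvec_inner v (u + w) = cvec_inner v u + cvec_inner v w"
  and cvec_inner_diff_right: "cvec_inner v (u - w) = cvec_inner v u - cvec_inner v w"
  and cvec_inner_scale_left: "cvec_inner (c *s u) v = cnj c * cvec_inner u v"
  and cvec_inner_scale_right: "cvec_inner v (c *s u) = c * cvec_inner v u"
  and cvec_inner_zero_right [simp]: "cvec_inner v 0 = 0"
  by (simp_all add: cvec_inner_def algebra_simps sum.distrib sum_subtractf sum_distrib_left)

lemma cvec_inner_self: "cvec_inner v v = complex_of_real ((norm v)\<^sup>2)"
proof -
  have "(norm v)\<^sup>2 = (\<Sum>i\<in>UNIV. (cmod (v $ i))\<^sup>2)"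
    by (simp add: norm_vec_def L2_set_def sum_nonneg)
  then show ?thesis
    by (simp only: cvec_inner_def complex_norm_square of_real_sum) (simp add: mult.commute)
qed

lemma cmat_scale_vector: "cmat_scale c A *v v = c *s (A *v v)"
  by (simp add: cmat_scale_def matrix_vector_mult_def vec_eq_iff sum_distrib_left mult.assoc)

lemma mat_vector: "mat c *v v = c *s (v :: complex^'n)"
  by (simp add: matrix_vector_mult_def mat_def vec_eq_iff if_distrib[where f = "\<lambda>x. x * _"]
      cong: if_cong)

lemma mat_eq_cmat_scale: "mat c = cmat_scale c (mat 1)"
  by (simp add: cmat_scale_def mat_def vec_eq_iff)

lemma matrix_vector_axis: "(b *v axis j c) $ i = b $ i $ j * c"
  for b :: "complex^'n^'n"
  by (simp add: matrix_vector_mult_def axis_def if_distrib cong: if_cong)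

lemma cvec_inner_axis_left: "cvec_inner (axis i c) w = cnj c * w $ i"
  by (simp add: cvec_inner_def axis_def if_distrib[where f = cnj]
      if_distrib[where f = "\<lambda>x. x * _"] cong: if_cong)

lemma cvec_inner_matrix_vector:
  "cvec_inner v (b *v v) = (\<Sum>i\<in>UNIV. \<Sum>j\<in>UNIV. cnj (v $ i) * b $ i $ j * v $ j)"
  by (simp add: cvec_inner_def matrix_vector_mult_def sum_distrib_left mult.assoc)

lemma cvec_inner_adjoint: "cvec_inner v (cmat_adjoint b *v v) = cnj (cvec_inner v (b *v v))"
proof -
  have "cnj (cvec_inner v (b *v v)) =
      (\<Sum>i\<in>UNIV. \<Sum>j\<in>UNIV. v $ i * cnj (b $ i $ j) * cnj (v $ j))"
    by (simp add: cvec_inner_matrix_vector)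
  also have "\<dots> = (\<Sum>j\<in>UNIV. \<Sum>i\<in>UNIV. v $ i * cnj (b $ i $ j) * cnj (v $ j))"
    by (rule sum.swap)
  finally show ?thesis
    by (simp add: cvec_inner_matrix_vector cmat_adjoint_def mult_ac)
qed

section \<open>Order properties and estimates for positive matrices\<close>

lemma cmat_nonneg_iff:
  "cmat_nonneg b \<longleftrightarrow>
    (\<forall>v. Im (cvec_inner v (b *v v)) = 0 \<and> 0 \<le> Re (cvec_inner v (b *v v)))"
  by (auto simp: cmat_nonneg_def complex_nonneg_Reals_iff)

lemma cmat_nonneg_add: "cmat_nonneg a \<Longrightarrow> cmat_nonneg b \<Longrightarrow> cmat_nonneg (a + b)"
  by (simp add: cmat_nonneg_iff matrix_vector_mult_add_rdistrib cvec_inner_add_right)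

lemma cmat_nonneg_scale: "cmat_nonneg b \<Longrightarrow> 0 \<le> c \<Longrightarrow> cmat_nonneg (cmat_scale (complex_of_real c) b)"
  by (simp add: cmat_nonneg_iff cmat_scale_vector cvec_inner_scale_right)

text \<open>Serves to enclose a Hermitian matrix between two multiples of the identity. Any constant
  does for that, so the crude sum of the moduli of the entries is taken.\<close>

lemma cvec_inner_bound: "\<exists>C\<ge>0. \<forall>v. cmod (cvec_inner v (b *v v)) \<le> C * (norm v)\<^sup>2"
proof (intro exI conjI allI)
  let ?C = "\<Sum>i\<in>UNIV. \<Sum>j\<in>UNIV. cmod (b $ i $ j)"
  show "0 \<le> ?C" by (intro sum_nonneg) simp
  fix v
  have "cmod (cvec_inner v (b *v v)) \<le>
      (\<Sum>i\<in>UNIV. \<Sum>j\<in>UNIV. cmod (cnj (v $ i) * b $ i $ j * v $ j))"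
    unfolding cvec_inner_matrix_vector by (intro order_trans[OF norm_sum] sum_mono norm_sum)
  also have "\<dots> \<le> (\<Sum>i\<in>UNIV. \<Sum>j\<in>UNIV. cmod (b $ i $ j) * (norm v)\<^sup>2)"
  proof (intro sum_mono)
    fix i j
    have "cmod (v $ i) * cmod (v $ j) \<le> norm v * norm v"
      by (intro mult_mono Finite_Cartesian_Product.norm_nth_le) auto
    then have "cmod (b $ i $ j) * (cmod (v $ i) * cmod (v $ j)) \<le> cmod (b $ i $ j) * (norm v * norm v)"
      by (rule mult_left_mono) simp
    then show "cmod (cnj (v $ i) * b $ i $ j * v $ j) \<le> cmod (b $ i $ j) * (norm v)\<^sup>2"
      by (simp add: norm_mult power2_eq_square mult_ac)
  qed
  finally show "cmod (cvec_inner v (b *v v)) \<le> ?C * (norm v)\<^sup>2"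
    by (simp add: sum_distrib_right)
qed

lemma linear_le_quadratic_imp_zero:
  fixes a q :: real
  assumes "\<And>t. 0 \<le> t * a + t\<^sup>2 * q" "0 \<le> q"
  shows "a = 0"
proof -
  \<comment> \<open>The value of \<open>t\<close> has the sign opposite to \<open>a\<close>;
    \<open>q + 1\<close> rather than \<open>q\<close> keeps the denominator positive when
    \<open>q = 0\<close>.\<close>
  have "0 \<le> (- a / (q + 1)) * a + (- a / (q + 1))\<^sup>2 * q" by (rule assms)
  also have "\<dots> = - (a\<^sup>2 / (q + 1)\<^sup>2)"
    using assms(2) by (simp add: divide_simps power2_eq_square) (simp add: algebra_simps)
  finally have "a\<^sup>2 / (q + 1)\<^sup>2 \<le> 0" by simp
  then show ?thesis using assms(2) by (simp add: divide_le_0_iff)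
qed

text \<open>The vector \<open>v\<close> minimizes the nonnegative quadratic form of
  \<open>P\<close>, so the first variation at \<open>v\<close> vanishes. Testing it in the direction
  \<open>w = P *v v\<close> produces the squared norm of \<open>w\<close>.\<close>

lemma cmat_nonneg_null_vector:
  assumes P: "cmat_nonneg P" and v: "cvec_inner v (P *v v) = 0"
  shows "P *v v = 0"
proof -
  define w where "w = P *v v"
  define q where "q = cvec_inner w (P *v w)"
  define b where "b = cvec_inner v (P *v w)"
  define N where "N = (norm w)\<^sup>2"
  have exp: "cvec_inner (v + c *s w) (P *v (v + c *s w)) =
      cnj c * complex_of_real N + c * b + cnj c * c * q" for c
    using v cvec_inner_self[of w]
    by (simp add: matrix_vector_right_distrib vector_scalar_commute cvec_inner_add_left
        cvec_inner_add_right cvec_inner_scale_left cvec_inner_scale_right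
        N_def q_def b_def w_def algebra_simps)
  have q: "Im q = 0" "0 \<le> Re q"
    using P by (auto simp: q_def cmat_nonneg_iff)
  have pos: "Im (cnj c * complex_of_real N + c * b + cnj c * c * q) = 0"
    "0 \<le> Re (cnj c * complex_of_real N + c * b + cnj c * c * q)" for c
    using P unfolding exp[symmetric] by (auto simp: cmat_nonneg_iff)
  \<comment> \<open>For real \<open>c\<close> the first-order coefficient of the form is
    \<open>N + Re b\<close>.\<close>
  have "N + Re b = 0"
  proof (rule linear_le_quadratic_imp_zero)
    show "0 \<le> t * (N + Re b) + t\<^sup>2 * Re q" for t
      using pos(2)[of "complex_of_real t"] by (simp add: algebra_simps power2_eq_square)
  qed (rule q)
  \<comment> \<open>At \<open>c = \<i>\<close> it is the realness of the form that is used: its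
    imaginary part is \<open>Re b - N\<close>.\<close>
  moreover have "Re b = N"
    using pos(1)[of \<i>] q by simp
  ultimately have "N = 0" by simp
  then show ?thesis by (simp add: N_def w_def)
qed

lemma trace_conv_cvec_inner: "trace b = (\<Sum>i\<in>UNIV. cvec_inner (axis i 1) (b *v axis i 1))"
  by (simp add: trace_def cvec_inner_axis_left matrix_vector_axis)

text \<open>Positivity on vectors supported on two coordinates bounds each off-diagonal pair of
  terms by diagonal ones. Summing over all pairs costs the factor \<open>CARD('n)\<close>, harmless
  where only some positive constant matters.\<close>

lemma cmat_nonneg_le_trace:
  fixes P :: "complex^'n^'n"
  assumes P: "cmat_nonneg P"
  shows "Re (cvec_inner v (P *v v)) \<le> real CARD('n) * (norm v)\<^sup>2 * Re (trace P)"
proof -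
  define d where "d i = (cmod (v $ i))\<^sup>2 * Re (P $ i $ i)" for i
  have diag: "0 \<le> Re (P $ i $ i)" for i
    using P[unfolded cmat_nonneg_iff, rule_format, of "axis i 1"]
    by (simp add: cvec_inner_axis_left matrix_vector_axis)
  have off: "Re (cnj (v $ i) * P $ i $ j * v $ j) + Re (cnj (v $ j) * P $ j $ i * v $ i) \<le> d i + d j"
    (is "?o \<le> _") for i j
  proof -
    \<comment> \<open>The minus sign moves the off-diagonal terms to the other side of the
      inequality; for \<open>i = j\<close> the vector is 0 and the bound is an equality.\<close>
    define x where "x = axis i (v $ i) + (- 1) *s axis j (v $ j)"
    have sq: "Re (cnj a * p * a) = (cmod a)\<^sup>2 * Re p" for a p
      unfolding cmod_power2 by (simp add: algebra_simps power2_eq_square)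
    have "0 \<le> Re (cvec_inner x (P *v x))"
      using P by (auto simp: cmat_nonneg_iff)
    also have "cvec_inner x (P *v x) =
        cnj (v $ i) * P $ i $ i * v $ i - cnj (v $ i) * P $ i $ j * v $ j
        - cnj (v $ j) * P $ j $ i * v $ i + cnj (v $ j) * P $ j $ j * v $ j"
      unfolding x_def
      by (simp only: matrix_vector_right_distrib vector_scalar_commute cvec_inner_add_left
          cvec_inner_add_right cvec_inner_scale_left cvec_inner_scale_right
          cvec_inner_axis_left matrix_vector_axis) simp
    also have "Re \<dots> = d i + d j - ?o"
      by (simp only: plus_complex.sel minus_complex.sel sq d_def)
    finally show ?thesis by simp
  qed
  let ?r = "\<lambda>i j. Re (cnj (v $ i) * P $ i $ j * v $ j)"
  \<comment> \<open>Doubling the sum and swapping the indices in one copy pairs each term with its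
    transpose, as \<open>off\<close> requires.\<close>
  have "2 * Re (cvec_inner v (P *v v)) = (\<Sum>i\<in>UNIV. \<Sum>j\<in>UNIV. ?r i j) + (\<Sum>j\<in>UNIV. \<Sum>i\<in>UNIV. ?r i j)"
    unfolding cvec_inner_matrix_vector Re_sum by (subst (3) sum.swap) simp
  also have "\<dots> = (\<Sum>i\<in>UNIV. \<Sum>j\<in>UNIV. ?r i j + ?r j i)"
    by (simp only: sum.distrib)
  also have "\<dots> \<le> (\<Sum>i\<in>UNIV. \<Sum>j\<in>UNIV. d i + d j)"
    by (intro sum_mono off)
  also have "\<dots> = 2 * (real CARD('n) * (\<Sum>i\<in>UNIV. d i))"
    by (simp add: sum.distrib sum_distrib_left)
  also have "(\<Sum>i\<in>UNIV. d i) \<le> (\<Sum>i\<in>UNIV. (norm v)\<^sup>2 * Re (P $ i $ i))"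
    unfolding d_def by (intro sum_mono mult_right_mono diag power_mono Finite_Cartesian_Product.norm_nth_le) simp
  finally show ?thesis
    by (simp add: trace_def sum_distrib_left[symmetric] mult.assoc)
qed

section \<open>Nilpotent positive maps\<close>

text \<open>The case of a single block.\<close>

lemma completely_positive_nonneg:
  assumes "completely_positive \<eta>" "cmat_nonneg b"
  shows "cmat_nonneg (\<eta> b)"
proof -
  have block: "block_nonneg 1 (\<lambda>i j. c) \<longleftrightarrow> cmat_nonneg c" for c :: "complex^'a^'a"
    by (auto simp: block_nonneg_def cmat_nonneg_def dest: spec[of _ "\<lambda>_. _"])
  then show ?thesis
    using assms unfolding completely_positive_def by blast
qed

lemma nilpotent_positive_map_null_vector:
  fixes \<eta> :: "complex^'n^'n \<Rightarrow> complex^'n^'n"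
  assumes lin: "Vector_Spaces.linear cmat_scale cmat_scale \<eta>"
    and pos: "\<And>b. cmat_nonneg b \<Longrightarrow> cmat_nonneg (\<eta> b)"
    and nil: "nilpotent_map \<eta>"
  obtains v where "v \<noteq> 0" "cvec_inner v (\<eta> (mat 1) *v v) = 0"
proof (rule ccontr)
  interpret Vector_Spaces.linear cmat_scale cmat_scale \<eta> by (rule lin)
  assume "\<not> thesis"
  with that have nz: "cvec_inner v (\<eta> (mat 1) *v v) \<noteq> 0" if "v \<noteq> 0" for v
    using \<open>v \<noteq> 0\<close> by blast
  have one: "cmat_nonneg (mat 1 :: complex^'n^'n)"
    by (simp add: cmat_nonneg_iff cvec_inner_self)
  define f where "f v = Re (cvec_inner v (\<eta> (mat 1) *v v))" for v
  have fim: "cvec_inner v (\<eta> (mat 1) *v v) = complex_of_real (f v)" and f0: "0 \<le> f v" for v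
    using pos[OF one] by (auto simp: f_def cmat_nonneg_iff complex_eq_iff)
  \<comment> \<open>By compactness the form of \<open>\<eta> (mat 1)\<close> attains a minimum
    \<open>c\<close> on the unit sphere, positive by \<open>nz\<close>; homogeneity then gives
    \<eta>(1) \<ge> c on all vectors.\<close>
  have "continuous_on (sphere 0 1) f"
    unfolding f_def cvec_inner_matrix_vector by (intro continuous_intros)
  moreover have "sphere 0 1 \<noteq> ({} :: (complex^'n) set)"
    by (metis mem_sphere_0 vector_choose_size zero_le_one empty_iff)
  ultimately obtain u where u: "norm u = 1" "\<And>v. norm v = 1 \<Longrightarrow> f u \<le> f v"
    using continuous_attains_inf[OF compact_sphere, of 0 1 f] by (auto simp: mem_sphere_0)
  define c where "c = f u"
  have "u \<noteq> 0" using u(1) by auto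
  then have c: "0 < c"
    using nz[of u] f0[of u] fim[of u] by (auto simp: c_def less_le)
  have ge: "c * (norm v)\<^sup>2 \<le> f v" for v
  proof (cases "v = 0")
    case False
    define w where "w = complex_of_real (1 / norm v) *s v"
    have "v = complex_of_real (norm v) *s w"
      using False by (simp add: w_def vec_eq_iff)
    then have fv: "f v = (norm v)\<^sup>2 * f w"
      unfolding f_def
      by (metis (no_types, lifting) vector_scalar_commute cvec_inner_scale_left
          cvec_inner_scale_right complex_cnj_complex_of_real mult.assoc Re_complex_of_real
          power2_eq_square fim of_real_mult)
    have "complex_of_real ((norm w)\<^sup>2) = 1"
      using False unfolding cvec_inner_self[symmetric]
      by (simp add: w_def cvec_inner_scale_left cvec_inner_scale_right)
         (simp add: cvec_inner_self power2_eq_square)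
    then have "(norm w)\<^sup>2 = 1" using of_real_eq_1_iff by blast
    then have "norm w = 1" by (simp add: power2_eq_1_iff) (smt (verit) norm_ge_zero)
    from u(2)[OF this] show ?thesis
      unfolding fv c_def by (simp add: mult.commute mult_right_mono)
  qed (simp add: f_def)
  have step: "cmat_nonneg (\<eta> (mat 1) - cmat_scale (complex_of_real c) (mat 1))"
    using ge by (simp add: cmat_nonneg_iff matrix_vector_mult_diff_rdistrib cvec_inner_diff_right
        cmat_scale_vector cvec_inner_scale_right cvec_inner_self fim)
  have pow: "cmat_nonneg ((\<eta> ^^ k) (mat 1) - cmat_scale (complex_of_real (c ^ k)) (mat 1))" for k
  proof (induction k)
    case 0
    show ?case by (simp add: cmat_nonneg_iff cmat_scale_def mat_def)
  next
    case (Suc k)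
    \<comment> \<open>Inserting \<open>c ^ k\<close> times \<open>\<eta> (mat 1)\<close> leaves the
      image of a positive matrix plus a nonnegative multiple of the matrix in
      \<open>step\<close>.\<close>
    have "(\<eta> ^^ Suc k) (mat 1) - cmat_scale (complex_of_real (c ^ Suc k)) (mat 1) =
        \<eta> ((\<eta> ^^ k) (mat 1) - cmat_scale (complex_of_real (c ^ k)) (mat 1)) +
        cmat_scale (complex_of_real (c ^ k)) (\<eta> (mat 1) - cmat_scale (complex_of_real c) (mat 1))"
      by (simp add: diff scale) (simp add: cmat_scale_def vec_eq_iff algebra_simps)
    then show ?case
      using c by (auto intro!: cmat_nonneg_add pos Suc.IH cmat_nonneg_scale step simp del: of_real_power)
  qed
  from nil obtain m where m: "\<eta> ^^ m = (\<lambda>_. 0)" by (auto simp: nilpotent_map_def)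
  have "0 \<le> - (c ^ m)"
    using pow[of m, unfolded m cmat_nonneg_iff matrix_vector_mult_diff_rdistrib
        cvec_inner_diff_right cmat_scale_vector cvec_inner_scale_right, rule_format, of u] u(1)
    by (simp add: cvec_inner_self flip: of_real_power)
  then show False using zero_less_power[OF c, of m] by simp
qed

text \<open>For Hermitian \<open>h\<close> and large \<open>C\<close>, both C + h and C - h are
  positive. The forms of their images at \<open>v\<close> are nonnegative and add up to 2C times
  that of \<eta>(1), which is 0; hence both vanish and \<open>v\<close> is a null vector of each
  image.\<close>

lemma positive_map_kills_null_vector:
  fixes \<eta> :: "complex^'n^'n \<Rightarrow> complex^'n^'n"
  assumes lin: "Vector_Spaces.linear cmat_scale cmat_scale \<eta>"
    and pos: "\<And>b. cmat_nonneg b \<Longrightarrow> cmat_nonneg (\<eta> b)"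
    and v: "cvec_inner v (\<eta> (mat 1) *v v) = 0"
  shows "\<eta> b *v v = 0"
proof -
  interpret Vector_Spaces.linear cmat_scale cmat_scale \<eta> by (rule lin)
  have herm: "\<eta> h *v v = 0" if h: "cmat_adjoint h = h" for h
  proof -
    have im: "Im (cvec_inner w (h *v w)) = 0" for w
      using cvec_inner_adjoint[of w h] h by (simp add: complex_eq_iff)
    obtain C where C: "0 \<le> C" "\<And>w. cmod (cvec_inner w (h *v w)) \<le> C * (norm w)\<^sup>2"
      using cvec_inner_bound[of h] by blast
    have abs: "\<bar>Re (cvec_inner w (h *v w))\<bar> \<le> C * (norm w)\<^sup>2" for w
      using C(2)[of w] abs_Re_le_cmod order_trans by blast
    define p m where "p = cmat_scale (complex_of_real C) (mat 1) + h"
      and "m = cmat_scale (complex_of_real C) (mat 1) - h"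
    have "cmat_nonneg p" "cmat_nonneg m"
      unfolding cmat_nonneg_iff p_def m_def
      using im abs by (auto simp: matrix_vector_mult_diff_rdistrib matrix_vector_mult_add_rdistrib
          cvec_inner_diff_right cvec_inner_add_right cmat_scale_vector cvec_inner_scale_right
          cvec_inner_self abs_le_iff simp flip: of_real_power) (smt (verit))+
    then have P: "cmat_nonneg (\<eta> p)" "cmat_nonneg (\<eta> m)" by (auto intro: pos)
    have "cvec_inner v (\<eta> p *v v) + cvec_inner v (\<eta> m *v v) = 0"
      by (simp add: p_def m_def add diff scale v matrix_vector_mult_diff_rdistrib
          matrix_vector_mult_add_rdistrib cvec_inner_diff_right cvec_inner_add_right
          cmat_scale_vector cvec_inner_scale_right)
    moreover have "Im (cvec_inner v (\<eta> p *v v)) = 0" "0 \<le> Re (cvec_inner v (\<eta> p *v v))"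
      "0 \<le> Re (cvec_inner v (\<eta> m *v v))"
      using P by (auto simp: cmat_nonneg_iff)
    ultimately have "cvec_inner v (\<eta> p *v v) = 0"
      by (simp add: complex_eq_iff)
    then have "\<eta> p *v v = 0" by (rule cmat_nonneg_null_vector[OF P(1)])
    moreover have "\<eta> (mat 1) *v v = 0"
      by (rule cmat_nonneg_null_vector[OF pos v]) (simp add: cmat_nonneg_iff cvec_inner_self)
    ultimately show ?thesis
      by (simp add: p_def add scale matrix_vector_mult_add_rdistrib cmat_scale_vector)
  qed
  \<comment> \<open>Cartesian decomposition of \<open>b\<close> reduces to the Hermitian
    case.\<close>
  define h1 where "h1 = cmat_scale (1 / 2) (b + cmat_adjoint b)"
  define h2 where "h2 = cmat_scale (1 / (2 * \<i>)) (b - cmat_adjoint b)"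
  have "cmat_adjoint h1 = h1" "cmat_adjoint h2 = h2"
    by (simp_all add: h1_def h2_def cmat_scale_def cmat_adjoint_def vec_eq_iff algebra_simps)
  note k = this[THEN herm]
  have "b = h1 + cmat_scale \<i> h2"
    by (simp add: h1_def h2_def cmat_scale_def cmat_adjoint_def vec_eq_iff field_simps)
  then have "\<eta> b = \<eta> h1 + cmat_scale \<i> (\<eta> h2)" by (simp add: add scale)
  then show ?thesis
    by (simp add: k matrix_vector_mult_add_rdistrib cmat_scale_vector)
qed

section \<open>Resolvents of self-adjoint elements\<close>

lemma scaleC_one [simp]: "1 *\<^sub>C x = (x :: 'a::cstar_algebra)"
  using scaleC_of_real[of 1 x] by simp

lemma scaleC_diff_right: "c *\<^sub>C (x - y) = c *\<^sub>C x - c *\<^sub>C (y :: 'a::cstar_algebra)"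
  using scaleC_add_right[of c "x - y" y] by (simp add: algebra_simps)

lemma scaleC_diff_left: "(c - d) *\<^sub>C x = c *\<^sub>C x - d *\<^sub>C (x :: 'a::cstar_algebra)"
  using scaleC_add_left[of "c - d" d x] by (simp add: algebra_simps)

lemma scaleC_minus_left: "(- c) *\<^sub>C x = - (c *\<^sub>C (x :: 'a::cstar_algebra))"
  using scaleC_diff_left[of 0 c x] scaleC_of_real[of 0 x] by simp

lemma star_diff: "star (x - y) = star x - star (y :: 'a::cstar_algebra)"
  using star_add[of "x - y" y] by (simp add: algebra_simps)

lemma star_one [simp]: "star 1 = (1 :: 'a::cstar_algebra)"
  by (metis mult_1_left mult_1_right star_mult star_star)

text \<open>Neumann series: multiplying it by \<open>x\<close> on either side removes exactly its
  first term.\<close>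

lemma one_minus_invertible:
  fixes x :: "'a::{real_normed_algebra_1,banach}"
  assumes "norm x < 1"
  shows "\<exists>y. (1 - x) * y = 1 \<and> y * (1 - x) = 1"
proof (intro exI conjI)
  have s: "summable (\<lambda>n. x ^ n)" by (rule complete_algebra_summable_geometric[OF assms])
  let ?y = "\<Sum>n. x ^ n"
  have split: "?y = 1 + (\<Sum>n. x ^ Suc n)" using suminf_split_head[OF s] by simp
  have "x * ?y = (\<Sum>n. x ^ Suc n)" using suminf_mult[OF s, of x] by simp
  then show "(1 - x) * ?y = 1" using split by (simp add: algebra_simps)
  have "?y * x = (\<Sum>n. x ^ Suc n)" using suminf_mult2[OF s, of x] by (simp add: power_commutes)
  then show "?y * (1 - x) = 1" using split by (simp add: algebra_simps)
qed

text \<open>Arens' trick: \<open>\<parallel>s + iL\<parallel>\<^sup>2 = \<parallel>s\<^sup>2 + L\<^sup>2\<parallel> < (y + L)\<^sup>2\<close> for large \<open>L\<close>, so the Neumann series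
  for \<open>iy - s = i (y + L) - (s + iL)\<close> converges.\<close>

lemma imaginary_minus_self_adjoint_invertible:
  fixes s :: "'a::cstar_algebra"
  assumes s: "star s = s" and y: "0 < y"
  shows "\<exists>x. ((\<i> * complex_of_real y) *\<^sub>C 1 - s) * x = 1 \<and> x * ((\<i> * complex_of_real y) *\<^sub>C 1 - s) = 1"
proof -
  \<comment> \<open>This choice makes the squared norm of \<open>s\<close> equal to
    \<open>y * L\<close>, so the bound \<open>y * L + L * L\<close> lies strictly below the square
    of \<open>y + L\<close>.\<close>
  define L where "L = (norm s)\<^sup>2 / y"
  define c where "c = \<i> * complex_of_real (y + L)"
  define a where "a = s + (\<i> * complex_of_real L) *\<^sub>C 1"
  have L: "0 \<le> L" using y by (simp add: L_def)
  have c0: "c \<noteq> 0" using y L by (simp add: c_def complex_eq_iff)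
  \<comment> \<open>The cross terms cancel because \<open>s\<close> is self-adjoint and the added
    scalar is purely imaginary.\<close>
  have "star a * a = s * s + complex_of_real (L * L) *\<^sub>C 1"
    by (simp add: a_def star_add star_scaleC s algebra_simps scaleC_mult_left scaleC_mult_right
        scaleC_scaleC scaleC_add_right scaleC_diff_right scaleC_minus_left)
  then have "(norm a)\<^sup>2 = norm (s * s + complex_of_real (L * L) *\<^sub>C 1)"
    by (simp flip: norm_star_mult_self)
  also have "\<dots> \<le> norm s * norm s + L * L"
    using norm_triangle_ineq[of "s * s" "complex_of_real (L * L) *\<^sub>C 1"] norm_mult_ineq[of s s]
    by (simp add: norm_scaleC del: of_real_mult)
  also have "\<dots> < (y + L)\<^sup>2"
  proof -
    have "norm s * norm s = y * L" using y by (simp add: L_def power2_eq_square)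
    moreover have "0 < y * y" "0 \<le> y * L" using y L by simp_all
    ultimately show ?thesis by (simp add: power2_eq_square algebra_simps)
  qed
  finally have "norm a < y + L"
    using y L by (simp add: power_less_imp_less_base)
  then have "norm ((1 / c) *\<^sub>C a) < 1"
    using y L by (simp add: norm_scaleC c_def norm_divide norm_mult del: of_real_add)
  then obtain u where u: "(1 - (1 / c) *\<^sub>C a) * u = 1" "u * (1 - (1 / c) *\<^sub>C a) = 1"
    using one_minus_invertible by blast
  have "(\<i> * complex_of_real y) *\<^sub>C 1 - s = c *\<^sub>C 1 - a"
    by (simp add: c_def a_def algebra_simps scaleC_add_left)
  also have "\<dots> = c *\<^sub>C (1 - (1 / c) *\<^sub>C a)"
    using c0 by (simp add: scaleC_diff_right scaleC_scaleC)
  finally show ?thesis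
    using u c0 by (intro exI[of _ "(1 / c) *\<^sub>C u"])
      (simp add: scaleC_mult_left scaleC_mult_right scaleC_scaleC)
qed

section \<open>Resolvents under the conditional expectation\<close>

lemma alg_inverse_eqI:
  assumes "x * y = 1" "y * x = 1"
  shows "alg_inverse x = y"
  unfolding alg_inverse_def
proof (rule the_equality)
  show "z = y" if "x * z = 1 \<and> z * x = 1" for z
    by (metis assms(2) mult.assoc mult_1_left mult_1_right that)
qed (use assms in simp)

text \<open>Positivity of \<open>E\<close> speaks only of elements \<open>star a * a\<close>.
  Polarization writes 2h as the difference of such an element for \<open>h + 1\<close> and those for
  \<open>h\<close> and 1.\<close>

lemma conditional_expectation_self_adjoint_real:
  assumes E: "conditional_expectation \<iota> E" and h: "star h = h"
  shows "Im (cvec_inner w (E h *v w)) = 0"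
proof -
  interpret Vector_Spaces.linear scaleC cmat_scale E
    using E by (simp add: conditional_expectation_def)
  have sq: "Im (cvec_inner w (E (star a * a) *v w)) = 0" for a
    using E by (simp add: conditional_expectation_def cmat_nonneg_iff)
  have "star (h + 1) * (h + 1) = h * h + h + h + 1"
    by (simp add: star_add h algebra_simps)
  then have "Im (cvec_inner w (E (h * h + h + h + 1) *v w)) = 0"
    using sq[of "h + 1"] by simp
  then show ?thesis
    using sq[of h] sq[of 1]
    unfolding add matrix_vector_mult_add_rdistrib cvec_inner_add_right h by simp
qed

lemma cauchy_transform_imaginary:
  fixes \<iota> :: "complex^'n^'n \<Rightarrow> 'a::cstar_algebra"
  assumes \<iota>: "unital_star_embedding \<iota>"
    and E: "conditional_expectation \<iota> E"
    and s: "self_adjoint s" and y: "0 < y"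
  obtains P where "cmat_nonneg P"
    and "\<And>w. Im (cvec_inner w (cauchy_transform \<iota> E s (mat (\<i> * complex_of_real y)) *v w)) =
      - y * Re (cvec_inner w (P *v w))"
proof -
  interpret I: Vector_Spaces.linear cmat_scale scaleC \<iota>
    using \<iota> by (simp add: unital_star_embedding_def)
  interpret Vector_Spaces.linear scaleC cmat_scale E
    using E by (simp add: conditional_expectation_def)
  let ?z = "\<i> * complex_of_real y"
  have s': "star s = s" using s by (simp add: self_adjoint_def)
  define b where "b = ?z *\<^sub>C 1 - s"
  obtain x where x: "b * x = 1" "x * b = 1"
    using imaginary_minus_self_adjoint_invertible[OF s' y] by (auto simp: b_def)
  have "\<iota> (mat ?z) = ?z *\<^sub>C 1"
    using \<iota> by (subst mat_eq_cmat_scale) (simp add: I.scale unital_star_embedding_def)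
  then have G: "cauchy_transform \<iota> E s (mat ?z) = E x"
    using alg_inverse_eqI[OF x] by (simp add: cauchy_transform_def b_def)
  have "star b * star x = 1" by (metis star_mult star_one x(2))
  then have "x = x * star b * star x" by (simp add: mult.assoc)
  also have "star b = (- ?z) *\<^sub>C 1 - s" by (simp add: b_def star_diff star_scaleC s')
  also have "x * \<dots> * star x = (- ?z) *\<^sub>C (x * star x) - x * s * star x"
    by (simp add: algebra_simps scaleC_mult_left scaleC_mult_right)
  finally have Ex: "E x = cmat_scale (- ?z) (E (x * star x)) - E (x * s * star x)"
    by (metis diff scale)
  \<comment> \<open>Positivity of \<open>E\<close> is applied to \<open>star x\<close>.\<close>
  have P: "cmat_nonneg (E (x * star x))"
    using E by (metis conditional_expectation_def star_star)
  have "star (x * s * star x) = x * s * star x"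
    by (simp add: star_mult star_star s' mult.assoc)
  note H = conditional_expectation_self_adjoint_real[OF E this]
  show thesis
  proof (rule that[OF P])
    show "Im (cvec_inner w (cauchy_transform \<iota> E s (mat ?z) *v w)) =
        - y * Re (cvec_inner w (E (x * star x) *v w))" for w
      unfolding G Ex matrix_vector_mult_diff_rdistrib cvec_inner_diff_right cmat_scale_vector
        cvec_inner_scale_right
      using H[of w] by simp
  qed
qed

section \<open>Atoms from the boundary behaviour of the Cauchy transform\<close>

lemma mat_imaginary_in_upper_half:
  assumes "0 < y"
  shows "mat (\<i> * complex_of_real y) \<in> (upper_half :: (complex^'n^'n) set)"
proof -
  have "cmat_Im (mat (\<i> * complex_of_real y)) = (mat (complex_of_real y) :: complex^'n^'n)"
    by (simp add: cmat_Im_def cmat_scale_def cmat_adjoint_def mat_def vec_eq_iff)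
  then show ?thesis
    using assms by (auto simp: upper_half_def cmat_nonneg_iff)
qed

lemma integral_Im_resolvent:
  assumes "real_distribution \<mu>" and y: "0 < y"
  shows "Im (\<integral>t. 1 / (\<i> * complex_of_real y - complex_of_real t) \<partial>\<mu>) =
    - (\<integral>t. y / (y\<^sup>2 + t\<^sup>2) \<partial>\<mu>)"
proof -
  interpret real_distribution \<mu> by fact
  \<comment> \<open>Integrability permits moving \<open>Im\<close> under the integral.\<close>
  have "integrable \<mu> (\<lambda>t. 1 / (\<i> * complex_of_real y - complex_of_real t))"
  proof (rule integrable_const_bound[where B = "1 / y"])
    show "AE t in \<mu>. cmod (1 / (\<i> * complex_of_real y - complex_of_real t)) \<le> 1 / y"
    proof (intro AE_I2)
      fix t
      have "y \<le> cmod (\<i> * complex_of_real y - complex_of_real t)"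
        using abs_Im_le_cmod[of "\<i> * complex_of_real y - complex_of_real t"] by simp
      then show "cmod (1 / (\<i> * complex_of_real y - complex_of_real t)) \<le> 1 / y"
        using y by (simp add: norm_divide frac_le)
    qed
  qed measurable
  then have "Im (\<integral>t. 1 / (\<i> * complex_of_real y - complex_of_real t) \<partial>\<mu>) =
      (\<integral>t. Im (1 / (\<i> * complex_of_real y - complex_of_real t)) \<partial>\<mu>)"
    by simp
  also have "\<dots> = (\<integral>t. - (y / (y\<^sup>2 + t\<^sup>2)) \<partial>\<mu>)"
    by (intro Bochner_Integration.integral_cong refl) (simp add: Im_divide power2_eq_square add.commute)
  finally show ?thesis by simp
qed

text \<open>Multiplied by y, the kernel of -Im is bounded by 1 and tends pointwise to the indicator
  of {0} as y tends to 0. Dominated convergence turns the bound into mass at 0.\<close>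

lemma atom_zero_if_resolvent_bound:
  assumes \<mu>: "real_distribution \<mu>" and c: "0 < c"
    and bound: "\<And>y. 0 < y \<Longrightarrow>
      c / y \<le> - Im (\<integral>t. 1 / (\<i> * complex_of_real y - complex_of_real t) \<partial>\<mu>)"
  shows "atom \<mu> 0"
proof -
  interpret real_distribution \<mu> by fact
  \<comment> \<open>A positive null sequence; \<open>Suc\<close> excludes division by zero.\<close>
  define y where "y k = 1 / real (Suc k)" for k
  have y: "0 < y k" for k by (simp add: y_def)
  have y_lim: "y \<longlonglongrightarrow> 0"
    unfolding y_def using LIMSEQ_Suc[OF lim_1_over_n] by simp
  have "(\<lambda>k. \<integral>t. (y k)\<^sup>2 / ((y k)\<^sup>2 + t\<^sup>2) \<partial>\<mu>) \<longlonglongrightarrow> (\<integral>t. indicat_real {0} t \<partial>\<mu>)"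
  proof (rule integral_dominated_convergence[where w = "\<lambda>_. 1"])
    show "AE t in \<mu>. (\<lambda>k. (y k)\<^sup>2 / ((y k)\<^sup>2 + t\<^sup>2)) \<longlonglongrightarrow> indicat_real {0} t"
    proof (intro AE_I2)
      fix t :: real
      show "(\<lambda>k. (y k)\<^sup>2 / ((y k)\<^sup>2 + t\<^sup>2)) \<longlonglongrightarrow> indicat_real {0} t"
      proof (cases "t = 0")
        case True
        then show ?thesis using y by (simp add: less_imp_neq[THEN not_sym])
      next
        case False
        then have "(\<lambda>k. (y k)\<^sup>2 / ((y k)\<^sup>2 + t\<^sup>2)) \<longlonglongrightarrow> 0\<^sup>2 / (0\<^sup>2 + t\<^sup>2)"
          by (intro tendsto_intros y_lim) auto
        then show ?thesis using False by simp
      qed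
    qed
    show "AE t in \<mu>. norm ((y k)\<^sup>2 / ((y k)\<^sup>2 + t\<^sup>2)) \<le> 1" for k
      using y[of k] by (intro AE_I2) (simp add: add_pos_nonneg)
  qed measurable
  moreover have "c \<le> (\<integral>t. (y k)\<^sup>2 / ((y k)\<^sup>2 + t\<^sup>2) \<partial>\<mu>)" for k
  proof -
    have "c / y k \<le> (\<integral>t. y k / ((y k)\<^sup>2 + t\<^sup>2) \<partial>\<mu>)"
      using bound[OF y] integral_Im_resolvent[OF \<mu> y] by simp
    then have "c \<le> y k * (\<integral>t. y k / ((y k)\<^sup>2 + t\<^sup>2) \<partial>\<mu>)"
      using y[of k] by (simp add: divide_le_eq mult.commute)
    also have "\<dots> = (\<integral>t. (y k)\<^sup>2 / ((y k)\<^sup>2 + t\<^sup>2) \<partial>\<mu>)"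
      by (simp add: power2_eq_square flip: integral_mult_right_zero)
    finally show ?thesis .
  qed
  ultimately have "c \<le> (\<integral>t. indicat_real {0} t \<partial>\<mu>)"
    by (intro LIMSEQ_le_const) auto
  then show ?thesis using c by (simp add: atom_def)
qed

section \<open>The lower bound on the imaginary axis and the atom at 0\<close>

theorem theorem4p1:
  fixes \<iota> :: "complex^'n^'n \<Rightarrow> 'a::cstar_algebra"
    and E :: "'a \<Rightarrow> complex^'n^'n"
    and \<eta> :: "complex^'n^'n \<Rightarrow> complex^'n^'n"
    and s :: 'a
    and \<mu> :: "real measure"
  assumes "unital_star_embedding \<iota>"
    and "conditional_expectation \<iota> E"
    and "completely_positive \<eta>"
    and "nilpotent_map \<eta>"
    and "semicircular \<iota> E 0 \<eta> s"
    and "associated_measure (cauchy_transform \<iota> E s) \<mu>"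
  shows "\<exists>r. atom \<mu> r"
proof -
  have lin: "Vector_Spaces.linear cmat_scale cmat_scale \<eta>"
    using assms(3) by (simp add: completely_positive_def)
  obtain v where v: "v \<noteq> 0" "cvec_inner v (\<eta> (mat 1) *v v) = 0"
    using nilpotent_positive_map_null_vector[OF lin completely_positive_nonneg[OF assms(3)] assms(4)]
    by blast
  have kill: "\<eta> b *v v = 0" for b
    by (rule positive_map_kills_null_vector[OF lin completely_positive_nonneg[OF assms(3)] v(2)])
  let ?N = "real CARD('n)"
  \<comment> \<open>One factor \<open>?N\<close> comes from comparing a form with the trace, the
    other from normalizing the trace.\<close>
  have "1 / (?N * ?N) / y \<le> - Im (\<integral>t. 1 / (\<i> * complex_of_real y - complex_of_real t) \<partial>\<mu>)"
    if y: "0 < y" for y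
  proof -
    let ?z = "\<i> * complex_of_real y"
    define G where "G = cauchy_transform \<iota> E s (mat ?z)"
    have "mat ?z ** G = mat 1 + (0 + \<eta> G) ** G"
      using assms(5) mat_imaginary_in_upper_half[OF y, where 'n = 'n]
      unfolding semicircular_def G_def by blast
    then have "(mat ?z - \<eta> G) ** G = mat 1"
      by (simp add: matrix_matrix_mult_def vec_eq_iff algebra_simps sum_subtractf)
    \<comment> \<open>The order is reversed so that \<open>\<eta> G\<close> acts on \<open>v\<close>
      first, where it vanishes.\<close>
    then have "G ** (mat ?z - \<eta> G) = mat 1"
      by (simp only: matrix_left_right_inverse)
    then have "G *v ((mat ?z - \<eta> G) *v v) = v"
      by (simp add: matrix_vector_mul_assoc)
    then have Gv: "?z *s (G *v v) = v"
      by (simp add: matrix_vector_mult_diff_rdistrib kill mat_vector vector_scalar_commute)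
    \<comment> \<open>Pairing with \<open>v\<close> and taking real parts yields the imaginary part
      of the form of \<open>G\<close> at \<open>v\<close>.\<close>
    have "?z * cvec_inner v (G *v v) = complex_of_real ((norm v)\<^sup>2)"
      unfolding cvec_inner_scale_right[symmetric] Gv cvec_inner_self ..
    then have ImG: "- y * Im (cvec_inner v (G *v v)) = (norm v)\<^sup>2"
      by (simp add: complex_eq_iff)
    obtain P where P: "cmat_nonneg P"
      and PG: "\<And>w. Im (cvec_inner w (G *v w)) = - y * Re (cvec_inner w (P *v w))"
      using cauchy_transform_imaginary[OF assms(1,2) _ y] assms(5)
      unfolding semicircular_def G_def by blast
    have tr: "Im (trace G) = - y * Re (trace P)"
      unfolding trace_conv_cvec_inner Im_sum Re_sum sum_distrib_left PG ..
    have "(norm v)\<^sup>2 = y * y * Re (cvec_inner v (P *v v))"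
      using ImG unfolding PG by simp
    also have "\<dots> \<le> y * y * (?N * (norm v)\<^sup>2 * Re (trace P))"
      by (intro mult_left_mono cmat_nonneg_le_trace[OF P]) simp
    finally have "(norm v)\<^sup>2 * 1 \<le> (norm v)\<^sup>2 * (y * y * ?N * Re (trace P))"
      by (simp add: mult_ac)
    then have "1 \<le> y * y * ?N * Re (trace P)"
      using v(1) by (subst (asm) mult_le_cancel_left_pos) auto
    then have "1 / (?N * ?N) / y \<le> y * Re (trace P) / ?N"
      using y by (simp add: divide_simps mult_ac)
    also have "\<dots> = - Im (trace G / of_nat CARD('n))"
      by (simp add: tr)
    also have "trace G / of_nat CARD('n) = (\<integral>t. 1 / (?z - complex_of_real t) \<partial>\<mu>)"
      using assms(6) y by (simp add: associated_measure_def G_def)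
    finally show ?thesis .
  qed
  moreover have "real_distribution \<mu>" "0 < 1 / (?N * ?N)"
    using assms(6) by (auto simp: associated_measure_def)
  ultimately show ?thesis
    using atom_zero_if_resolvent_bound by blast
qed

end
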